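(* Let $(X,\rho)$ be a complete, unbounded hyperbolic metric space (with coherent system of geodesics $\Gamma$) and let $\omega:[0,+\infty)\to[0,+\infty)$ be a continuous, concave, nonzero and nondecreasing function with $\omega(0)=0$. Endow $\mathcal{C}_\omega(X)$ with the topology of uniform convergence on bounded sets. Then there is a meagre set $\mathcal{M}\subset\mathcal{C}_\omega(X)$ such that $\omega_f=\omega$ for every $f\in\mathcal{C}_\omega(X)\setminus\mathcal{M}$.
   Context: A metric space $(X,\rho)$ is geodesic-type with a coherent system of geodesics $\Gamma$ if $\Gamma$ is a family of isometries $\gamma:[0,\rho(x,y)]\to X$ with $\gamma(0)=x$, $\gamma(\rho(x,y))=y$ such that: (1) for all $x,y\in X$ there is a unique $\gamma\in\Gamma$ from $x$ to $y$; (2) if $\gamma\in\Gamma$ goes from $x$ to $y$, then $t\mapsto\gamma(\rho(x,y)-t)$ is the element of $\Gamma$ from $y$ to $x$; (3) if $\gamma\in\Gamma$ goes from $x$ to $y$ and $0\le t_1\le t_2\le\rho(x,y)$, then $t\mapsto\gamma(t+t_1)$, $t\in[0,t_2-t_1]$, is the element of $\Gamma$ from $\gamma(t_1)$ to $\gamma(t_2)$. For $x,y\in X$, $t\in[0,1]$ write $(1-t)x\oplus ty=\gamma(t\rho(x,y))$ where $\gamma\in\Gamma$ is the geodesic from $x$ to $y$. The space is hyperbolic if $\rho((1-t)x\oplus ty,(1-t)x\oplus tz)\le t\rho(y,z)$ for all $x,y,z\in X$, $t\in[0,1]$. For a map $f:X\to X$, its modulus of continuity is $\omega_f(s)=\sup\{\rho(f(x),f(y)):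 x,y\in X,\ \rho(x,y)\le s\}$ for $s\ge0$. $\mathcal{C}_\omega(X)$ is the set of all maps $f:X\to X$ with $\omega_f\le\omega$ pointwise. The topology of uniform convergence on bounded sets on $\mathcal{C}_\omega(X)$ is given by the metric $d(f,g)=\sum_{n=1}^\infty 2^{-n}\sup_{\rho(x,x_0)\le n}\min\{1,\rho(f(x),g(x))\}$ for a fixed $x_0\in X$. *)

theory Defs
  imports "HOL-Analysis.Analysis"
begin

text \<open>A coherent system of geodesics, represented by the map G with G x y the
  (unique) geodesic from x to y, considered on [0, dist x y].\<close>
definition coherent_geodesics :: "('a::metric_space \<Rightarrow> 'a \<Rightarrow> real \<Rightarrow> 'a) \<Rightarrow> bool" where
  "coherent_geodesics G \<longleftrightarrow>
     (\<forall>x y. (\<forall>s\<in>{0..dist x y}. \<forall>t\<in>{0..dist x y}. dist (G x y s) (G x y t) = \<bar>s - t\<bar>)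
          \<and> G x y 0 = x \<and> G x y (dist x y) = y)
   \<and> (\<forall>x y. \<forall>t\<in>{0..dist x y}. G y x t = G x y (dist x y - t))
   \<and> (\<forall>x y t1 t2. 0 \<le> t1 \<and> t1 \<le> t2 \<and> t2 \<le> dist x y \<longrightarrow>
        (\<forall>t\<in>{0..t2 - t1}. G (G x y t1) (G x y t2) t = G x y (t + t1)))"

definition geo_comb :: "('a::metric_space \<Rightarrow> 'a \<Rightarrow> real \<Rightarrow> 'a) \<Rightarrow> real \<Rightarrow> 'a \<Rightarrow> 'a \<Rightarrow> 'a" where
  "geo_comb G t x y = G x y (t * dist x y)"

definition hyperbolic_geo :: "('a::metric_space \<Rightarrow> 'a \<Rightarrow> real \<Rightarrow> 'a) \<Rightarrow> bool" where
  "hyperbolic_geo G \<longleftrightarrow> (\<forall>x y z. \<forall>t\<in>{0..1}.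
      dist (geo_comb G t x y) (geo_comb G t x z) \<le> t * dist y z)"

definition modulus :: "('a::metric_space \<Rightarrow> 'a) \<Rightarrow> real \<Rightarrow> ereal" where
  "modulus f s = (SUP p\<in>{(x, y). dist x y \<le> s}. ereal (dist (f (fst p)) (f (snd p))))"

definition C_omega :: "(real \<Rightarrow> real) \<Rightarrow> ('a::metric_space \<Rightarrow> 'a) set" where
  "C_omega \<omega> = {f. \<forall>s\<ge>0. modulus f s \<le> ereal (\<omega> s)}"

text \<open>Metric of uniform convergence on bounded sets, based at x0.\<close>
definition ucb_dist :: "'a::metric_space \<Rightarrow> ('a \<Rightarrow> 'a) \<Rightarrow> ('a \<Rightarrow> 'a) \<Rightarrow> real" where
  "ucb_dist x0 f g = (\<Sum>n. (1/2) ^ (Suc n) *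
      Sup ((\<lambda>x. min 1 (dist (f x) (g x))) ` {x. dist x x0 \<le> real (Suc n)}))"

definition ucb_topology :: "(real \<Rightarrow> real) \<Rightarrow> 'a::metric_space \<Rightarrow> ('a \<Rightarrow> 'a) topology" where
  "ucb_topology \<omega> x0 = Metric_space.mtopology (C_omega \<omega>) (ucb_dist x0)"

definition nowhere_dense_in :: "'a topology \<Rightarrow> 'a set \<Rightarrow> bool" where
  "nowhere_dense_in T S \<longleftrightarrow> S \<subseteq> topspace T \<and> T interior_of (T closure_of S) = {}"

definition meagre_in :: "'a topology \<Rightarrow> 'a set \<Rightarrow> bool" where
  "meagre_in T M \<longleftrightarrow> (\<exists>\<F>. countable \<F> \<and> (\<forall>S\<in>\<F>. nowhere_dense_in T S) \<and> M = \<Union>\<F>)"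

end

theory Submission
  imports Defs
begin

text \<open>For rational s and v with v < \<omega> s, the maps whose modulus at s is at most v form a closed
  set; it suffices that each such set has empty interior. A map f is perturbed as follows.
  Pulling f x towards f p by the proportion min 1 (k * dist x p) keeps f in the class, because
  \<omega> r / r is nonincreasing, changes f little on a given ball when k is small, and makes f
  constant outside a larger ball. Near a point z far away the constant c = f p is replaced by
  points on a geodesic from c to some c' with parameter max 0 (v - \<omega> (dist x z)), so that the
  modulus at s becomes at least v.

  The new values must not be further from the old ones than \<omega> allows. This is automatic
  if \<omega> is unbounded. If B = sup \<omega> is finite, f is first contracted so that its range has diameter
  less than B; then c' is chosen so that its largest distance from the range lies
  strictly between v and B, and p so that f p nearly attains that distance.\<close>

section \<open>The metric of uniform convergence on bounded sets\<close>

text \<open>A pseudometric rather than a seminorm: truncation at 1 keeps it finite for arbitrary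
  maps. Index \<open>n\<close> belongs to the ball of radius \<open>n + 1\<close>, because the
  series defining the metric starts at 1.\<close>

definition ucb_seminorm :: "'a::metric_space \<Rightarrow> nat \<Rightarrow> ('a \<Rightarrow> 'a) \<Rightarrow> ('a \<Rightarrow> 'a) \<Rightarrow> real" where
  "ucb_seminorm x0 n f g =
     Sup ((\<lambda>x. min 1 (dist (f x) (g x))) ` {x. dist x x0 \<le> real (Suc n)})"

lemma ucb_dist_eq: "ucb_dist x0 f g = (\<Sum>n. (1/2) ^ Suc n * ucb_seminorm x0 n f g)"
  unfolding ucb_dist_def ucb_seminorm_def ..

lemma ucb_seminorm_upper:
  assumes "dist x x0 \<le> real (Suc n)"
  shows "min 1 (dist (f x) (g x)) \<le> ucb_seminorm x0 n f g"
  unfolding ucb_seminorm_def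
  by (rule cSUP_upper) (use assms in \<open>auto intro!: bdd_aboveI2[where M = 1]\<close>)

lemma ucb_seminorm_least:
  assumes "\<And>x. dist x x0 \<le> real (Suc n) \<Longrightarrow> min 1 (dist (f x) (g x)) \<le> e"
  shows "ucb_seminorm x0 n f g \<le> e"
  unfolding ucb_seminorm_def
proof (rule cSUP_least)
  show "{x. dist x x0 \<le> real (Suc n)} \<noteq> {}"
    by (auto intro!: exI[of _ x0])
qed (use assms in auto)

lemma ucb_seminorm_nonneg: "0 \<le> ucb_seminorm x0 n f g"
  using ucb_seminorm_upper[of x0 x0 n f g] by (smt (verit) dist_self of_nat_0_le_iff zero_le_dist)

lemma ucb_seminorm_le_1: "ucb_seminorm x0 n f g \<le> 1"
  by (rule ucb_seminorm_least) auto

lemma ucb_seminorm_commute: "ucb_seminorm x0 n f g = ucb_seminorm x0 n g f"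
  unfolding ucb_seminorm_def by (simp add: dist_commute)

lemma ucb_seminorm_triangle:
  "ucb_seminorm x0 n f h \<le> ucb_seminorm x0 n f g + ucb_seminorm x0 n g h"
proof (rule ucb_seminorm_least)
  fix x assume x: "dist x x0 \<le> real (Suc n)"
  have "min 1 (dist (f x) (h x)) \<le> min 1 (dist (f x) (g x)) + min 1 (dist (g x) (h x))"
    using dist_triangle[of "f x" "h x" "g x"] zero_le_dist[of "f x" "g x"] zero_le_dist[of "g x" "h x"]
    by linarith
  then show "min 1 (dist (f x) (h x)) \<le> ucb_seminorm x0 n f g + ucb_seminorm x0 n g h"
    using ucb_seminorm_upper[OF x, of f g] ucb_seminorm_upper[OF x, of g h] by linarith
qed

lemma half_powers_sums: "(\<lambda>n. (1/2::real) ^ Suc n) sums 1"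
  using power_half_series by simp

lemma ucb_terms_summable: "summable (\<lambda>n. (1/2) ^ Suc n * ucb_seminorm x0 n f g)"
proof (rule summable_comparison_test'[OF sums_summable[OF half_powers_sums], of 0])
  show "norm ((1/2) ^ Suc n * ucb_seminorm x0 n f g) \<le> (1/2) ^ Suc n" for n
    using ucb_seminorm_nonneg[of x0 n f g] ucb_seminorm_le_1[of x0 n f g]
    by (simp add: abs_mult mult_left_le)
qed

lemma ucb_term_le_ucb_dist: "(1/2) ^ Suc n * ucb_seminorm x0 n f g \<le> ucb_dist x0 f g"
  unfolding ucb_dist_eq
  using sum_le_suminf[OF ucb_terms_summable, of "{n}" x0 f g] ucb_seminorm_nonneg[of x0 _ f g]
  by simp

lemma ucb_dist_nonneg: "0 \<le> ucb_dist x0 f g"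
  unfolding ucb_dist_eq by (intro suminf_nonneg ucb_terms_summable) (simp add: ucb_seminorm_nonneg)

text \<open>A single term of the series is at most the whole sum, so closeness in the metric
  controls values at individual points; the factor undoes the weight.\<close>

lemma min_dist_le_ucb_dist:
  assumes "dist x x0 \<le> real (Suc n)"
  shows "min 1 (dist (f x) (g x)) \<le> 2 ^ Suc n * ucb_dist x0 f g"
proof -
  have "(1/2) ^ Suc n * min 1 (dist (f x) (g x)) \<le> (1/2) ^ Suc n * ucb_seminorm x0 n f g"
    by (intro mult_left_mono ucb_seminorm_upper assms) simp
  also have "\<dots> \<le> ucb_dist x0 f g"
    by (rule ucb_term_le_ucb_dist)
  finally have "2 ^ Suc n * ((1/2) ^ Suc n * min 1 (dist (f x) (g x))) \<le> 2 ^ Suc n * ucb_dist x0 f g"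
    by (intro mult_left_mono) auto
  then show ?thesis
    by (simp only: mult.assoc[symmetric] power_mult_distrib[symmetric]) simp
qed

text \<open>Truncation makes every series converge, so symmetry and the triangle inequality pass
  from the terms to the sum. For separation, each point lies in one of the balls.\<close>

lemma ucb_dist_Metric_space: "Metric_space M (ucb_dist x0)"
proof
  show "0 \<le> ucb_dist x0 f g" for f g :: "'a \<Rightarrow> 'a"
    by (rule ucb_dist_nonneg)
  show "ucb_dist x0 f g = ucb_dist x0 g f" for f g :: "'a \<Rightarrow> 'a"
    unfolding ucb_dist_eq by (simp add: ucb_seminorm_commute)
  show "ucb_dist x0 f g = 0 \<longleftrightarrow> f = g" for f g :: "'a \<Rightarrow> 'a"
  proof
    assume eq: "ucb_dist x0 f g = 0"
    show "f = g"
    proof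
      fix x
      obtain n where "dist x x0 \<le> real n"
        using real_arch_simple by blast
      then have "dist x x0 \<le> real (Suc n)"
        by simp
      from min_dist_le_ucb_dist[OF this, of f g] have "dist (f x) (g x) \<le> 0"
        unfolding eq by linarith
      then show "f x = g x"
        by simp
    qed
  next
    assume "f = g"
    then have "ucb_seminorm x0 n f g = 0" for n
      using ucb_seminorm_least[of x0 n f g 0] ucb_seminorm_nonneg[of x0 n f g] by simp
    then show "ucb_dist x0 f g = 0"
      unfolding ucb_dist_eq by simp
  qed
  show "ucb_dist x0 f h \<le> ucb_dist x0 f g + ucb_dist x0 g h" for f g h :: "'a \<Rightarrow> 'a"
    unfolding ucb_dist_eq suminf_add[OF ucb_terms_summable ucb_terms_summable]
  proof (rule suminf_le)
    show "(1/2) ^ Suc n * ucb_seminorm x0 n f h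
        \<le> (1/2) ^ Suc n * ucb_seminorm x0 n f g + (1/2) ^ Suc n * ucb_seminorm x0 n g h" for n
      unfolding distrib_left[symmetric] by (intro mult_left_mono ucb_seminorm_triangle) simp
  qed (intro summable_add ucb_terms_summable)+
qed

text \<open>The first \<open>N\<close> terms see only balls of radius at most \<open>N\<close> and
  have total weight at most 1; the weights of the tail add up to \<open>(1/2) ^ N\<close>.\<close>

lemma ucb_dist_le:
  assumes close: "\<And>x. dist x x0 \<le> real N \<Longrightarrow> dist (f x) (g x) \<le> e" and e: "0 \<le> e"
  shows "ucb_dist x0 f g \<le> e + (1/2) ^ N"
proof -
  let ?a = "\<lambda>n. (1/2) ^ Suc n * ucb_seminorm x0 n f g"
  have "(\<Sum>n<N. ?a n) \<le> (\<Sum>n<N. (1/2) ^ Suc n * e)"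
  proof (intro sum_mono mult_left_mono ucb_seminorm_least)
    fix n x assume "n \<in> {..<N}" "dist x x0 \<le> real (Suc n)"
    then have "dist x x0 \<le> real N"
      by (auto simp: less_eq_Suc_le intro: order_trans)
    then show "min 1 (dist (f x) (g x)) \<le> e"
      using close by (simp add: min.coboundedI2)
  qed simp
  also have "\<dots> = (\<Sum>n<N. (1/2) ^ Suc n) * e"
    by (simp add: sum_distrib_right)
  also have "\<dots> \<le> 1 * e"
    using sum_le_suminf[OF sums_summable[OF half_powers_sums], of "{..<N}"]
      sums_unique[OF half_powers_sums] e
    by (intro mult_right_mono) auto
  finally have head: "(\<Sum>n<N. ?a n) \<le> e"
    by simp
  have tail_sums: "(\<lambda>n. (1/2::real) ^ N * (1/2) ^ Suc n) sums ((1/2) ^ N * 1)"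
    by (intro sums_mult half_powers_sums)
  have "(\<Sum>n. ?a (n + N)) \<le> (\<Sum>n. (1/2::real) ^ N * (1/2) ^ Suc n)"
  proof (rule suminf_le)
    show "?a (n + N) \<le> (1/2) ^ N * (1/2) ^ Suc n" for n
      using mult_left_mono[OF ucb_seminorm_le_1[of x0 "n + N" f g], of "(1/2) ^ Suc (n + N)"]
      by (simp add: power_add mult_ac)
    show "summable (\<lambda>n. ?a (n + N))"
      by (rule summable_ignore_initial_segment[OF ucb_terms_summable])
    show "summable (\<lambda>n. (1/2::real) ^ N * (1/2) ^ Suc n)"
      using tail_sums by (rule sums_summable)
  qed
  also have "\<dots> = (1/2) ^ N"
    using sums_unique[OF tail_sums] by simp
  finally show ?thesis
    unfolding ucb_dist_eq suminf_split_initial_segment[OF ucb_terms_summable, of x0 f g N]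
    using head by linarith
qed

section \<open>Concave moduli and hyperbolic spaces\<close>

locale concave_modulus =
  fixes \<omega> :: "real \<Rightarrow> real"
  assumes concave: "concave_on {0..} \<omega>"
    and mono: "mono_on {0..} \<omega>"
    and zero: "\<omega> 0 = 0"
begin

lemma le: "0 \<le> a \<Longrightarrow> a \<le> b \<Longrightarrow> \<omega> a \<le> \<omega> b"
  using mono by (auto simp: mono_on_def)

lemma nonneg: "0 \<le> a \<Longrightarrow> 0 \<le> \<omega> a"
  using le[of 0 a] zero by simp

text \<open>Concavity between 0 and \<open>a\<close>, with \<open>\<omega> 0 = 0\<close>; this is
  the form in which the monotonicity of \<open>\<omega> r / r\<close> is used.\<close>

lemma scale:
  assumes "0 \<le> t" "t \<le> 1" "0 \<le> a"
  shows "t * \<omega> a \<le> \<omega> (t * a)"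
  using concave assms convex_onD[of "{0..}" "\<lambda>x. - \<omega> x" t 0 a] zero
  unfolding concave_on_def by simp

text \<open>Apply \<open>scale\<close> to \<open>a + b\<close> with the proportions
  \<open>a / (a + b)\<close> and \<open>b / (a + b)\<close>, which add up to 1.\<close>

lemma subadditive:
  assumes "0 \<le> a" "0 \<le> b"
  shows "\<omega> (a + b) \<le> \<omega> a + \<omega> b"
proof (cases "a + b = 0")
  case True
  then show ?thesis
    using assms zero by (simp add: add_nonneg_eq_0_iff)
next
  case False
  then have pos: "a + b > 0"
    using assms by simp
  have "a / (a + b) * \<omega> (a + b) + b / (a + b) * \<omega> (a + b) \<le> \<omega> a + \<omega> b"
    using scale[of "a / (a + b)" "a + b"] scale[of "b / (a + b)" "a + b"] assms pos
    by (intro add_mono) (auto simp: divide_simps)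
  moreover have "a / (a + b) * \<omega> (a + b) + b / (a + b) * \<omega> (a + b) = \<omega> (a + b)"
    using pos by (simp add: divide_simps) (simp add: algebra_simps)
  ultimately show ?thesis
    by simp
qed

lemma abs_diff_le:
  assumes "0 \<le> a" "0 \<le> b"
  shows "\<bar>\<omega> a - \<omega> b\<bar> \<le> \<omega> \<bar>a - b\<bar>"
proof (cases "a \<le> b")
  case True
  then show ?thesis
    using subadditive[of a "b - a"] le[of a b] assms by simp
next
  case False
  then show ?thesis
    using subadditive[of b "a - b"] le[of b a] assms by simp
qed

text \<open>This pays for the change of the cutoff factor in \<open>cutoff_C_omega\<close>. If
  \<open>r \<le> r' - r\<close>, monotonicity suffices. Otherwise the inequality is proved with the
  identity in place of \<omega> and multiplied by \<open>\<omega> r / r\<close>; then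
  \<open>scale\<close> applies with the proportion \<open>(r' - r) / r\<close>.\<close>

lemma cutoff_increment:
  assumes "0 \<le> r" "r \<le> r'" "0 \<le> k"
  shows "(min 1 (k * r') - min 1 (k * r)) * \<omega> r \<le> min 1 (k * r') * \<omega> (r' - r)"
proof (cases "r \<le> r' - r")
  case True
  moreover have "0 \<le> min 1 (k * r)" "0 \<le> min 1 (k * r')"
    using assms by auto
  ultimately show ?thesis
    using assms by (intro mult_mono le nonneg) linarith+
next
  case False
  then have r: "0 < r" "r' < 2 * r"
    using assms by auto
  have increment: "(min 1 (k * r') - min 1 (k * r)) * r \<le> min 1 (k * r') * (r' - r)"
  proof (cases "1 \<le> k * r")
    case True
    moreover have "k * r \<le> k * r'"
      using assms by (intro mult_left_mono)
    ultimately show ?thesis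
      using assms by (simp add: min_def)
  next
    case False
    \<comment> \<open>Since \<open>min 1 (k * r) = k * r\<close> here, the claim rearranges to
      \<open>min 1 (k * r') * (2 * r - r') \<le> k * r * r\<close>, a consequence of the
      nonnegativity of the square of \<open>r - r'\<close>.\<close>
    have "min 1 (k * r') * (2 * r - r') \<le> k * r' * (2 * r - r')"
      using r by (intro mult_right_mono) auto
    also have "\<dots> \<le> k * r * r"
      using mult_nonneg_nonneg[OF \<open>0 \<le> k\<close> zero_le_power2[of "r - r'"]]
      by (simp add: power2_eq_square algebra_simps)
    finally show ?thesis
      using False by (simp add: algebra_simps)
  qed
  have "(min 1 (k * r') - min 1 (k * r)) * \<omega> r
      = ((min 1 (k * r') - min 1 (k * r)) * r) * (\<omega> r / r)"
    using r by simp
  also have "\<dots> \<le> (min 1 (k * r') * (r' - r)) * (\<omega> r / r)"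
    using increment r by (intro mult_right_mono divide_nonneg_pos nonneg) auto
  also have "\<dots> = min 1 (k * r') * ((r' - r) / r * \<omega> r)"
    by simp
  also have "\<dots> \<le> min 1 (k * r') * \<omega> (r' - r)"
    using scale[of "(r' - r) / r" r] r assms by (intro mult_left_mono) auto
  finally show ?thesis .
qed

lemma C_omega_iff:
  "f \<in> C_omega \<omega> \<longleftrightarrow> (\<forall>x y. dist (f x) (f y) \<le> \<omega> (dist x y))"
proof
  assume f: "f \<in> C_omega \<omega>"
  show "\<forall>x y. dist (f x) (f y) \<le> \<omega> (dist x y)"
  proof (intro allI)
    fix x y
    have "ereal (dist (f x) (f y)) \<le> modulus f (dist x y)"
      unfolding modulus_def by (rule SUP_upper2[of "(x, y)"]) auto
    also have "\<dots> \<le> ereal (\<omega> (dist x y))"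
      using f by (simp add: C_omega_def)
    finally show "dist (f x) (f y) \<le> \<omega> (dist x y)"
      by simp
  qed
next
  assume f: "\<forall>x y. dist (f x) (f y) \<le> \<omega> (dist x y)"
  have "dist (f x) (f y) \<le> \<omega> s" if "dist x y \<le> s" for x y s
    using f le[of "dist x y" s] that by (meson order_trans zero_le_dist)
  then show "f \<in> C_omega \<omega>"
    unfolding C_omega_def modulus_def by (auto intro!: SUP_least)
qed

end

section \<open>Geodesics in unbounded hyperbolic spaces\<close>

locale hyperbolic_space =
  fixes G :: "'a::metric_space \<Rightarrow> 'a \<Rightarrow> real \<Rightarrow> 'a"
  assumes coherent: "coherent_geodesics G"
    and hyperbolic: "hyperbolic_geo G"
    and unbounded: "\<not> bounded (UNIV :: 'a set)"
begin

lemma G_dist: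
  "0 \<le> s \<Longrightarrow> s \<le> dist x y \<Longrightarrow> 0 \<le> t \<Longrightarrow> t \<le> dist x y \<Longrightarrow> dist (G x y s) (G x y t) = \<bar>s - t\<bar>"
  using coherent unfolding coherent_geodesics_def by auto

lemma G_0 [simp]: "G x y 0 = x"
  using coherent unfolding coherent_geodesics_def by auto

lemma G_end [simp]: "G x y (dist x y) = y"
  using coherent unfolding coherent_geodesics_def by auto

lemma geo_comb_0 [simp]: "geo_comb G 0 x y = x"
  by (simp add: geo_comb_def)

lemma geo_comb_1 [simp]: "geo_comb G 1 x y = y"
  by (simp add: geo_comb_def)

lemma geo_comb_dist:
  assumes "0 \<le> s" "s \<le> 1" "0 \<le> t" "t \<le> 1"
  shows "dist (geo_comb G s x y) (geo_comb G t x y) = \<bar>s - t\<bar> * dist x y"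
proof -
  have "dist (geo_comb G s x y) (geo_comb G t x y) = \<bar>s * dist x y - t * dist x y\<bar>"
    unfolding geo_comb_def using assms by (intro G_dist) (auto simp: mult_left_le_one_le)
  then show ?thesis
    by (simp add: left_diff_distrib[symmetric] abs_mult)
qed

lemma geo_comb_contract:
  "0 \<le> t \<Longrightarrow> t \<le> 1 \<Longrightarrow> dist (geo_comb G t x y) (geo_comb G t x z) \<le> t * dist y z"
  using hyperbolic unfolding hyperbolic_geo_def by auto

text \<open>Compare with the point at proportion \<open>t\<close> from \<open>x\<close> to
  \<open>p\<close>: it has distance \<open>(1 - t) * dist p x\<close> from \<open>p\<close>, and
  hyperbolicity puts it within \<open>t * dist p y\<close> of \<open>geo_comb G t x y\<close>. Thus
  closed balls are geodesically convex.\<close>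

lemma dist_geo_comb_le:
  assumes t: "0 \<le> t" "t \<le> 1" and "dist p x \<le> e" "dist p y \<le> e"
  shows "dist p (geo_comb G t x y) \<le> e"
proof -
  have "dist p (geo_comb G t x y)
      \<le> dist (geo_comb G 1 x p) (geo_comb G t x p) + dist (geo_comb G t x p) (geo_comb G t x y)"
    using dist_triangle[of p "geo_comb G t x y" "geo_comb G t x p"] by simp
  also have "\<dots> \<le> (1 - t) * dist p x + t * dist p y"
    using geo_comb_dist[of 1 t x p] geo_comb_contract[of t x p y] t by (simp add: dist_commute)
  also have "\<dots> \<le> (1 - t) * e + t * e"
    using assms by (intro add_mono mult_left_mono) auto
  finally show ?thesis
    by (simp add: algebra_simps)
qed

lemma dist_G_le:
  assumes t: "0 \<le> t" "t \<le> dist x y" and "dist p x \<le> e" "dist p y \<le> e"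
  shows "dist p (G x y t) \<le> e"
proof (cases "dist x y = 0")
  case True
  then show ?thesis
    using assms by simp
next
  case False
  then have "G x y t = geo_comb G (t / dist x y) x y"
    by (simp add: geo_comb_def)
  then show ?thesis
    using assms False dist_geo_comb_le[of "t / dist x y" p x e y] by (simp add: divide_simps)
qed

lemma far_point:
  fixes p :: 'a
  obtains w where "dist p w \<ge> r"
proof -
  have "\<not> (\<forall>w. dist p w \<le> r)"
    using unbounded unfolding bounded_any_center[where a = p] by blast
  then show thesis
    using that by (auto simp: not_le intro: less_imp_le)
qed

end

section \<open>Approximation by maps with large modulus\<close>

locale hyperbolic_modulus = hyperbolic_space G + concave_modulus \<omega>
  for G :: "'a::metric_space \<Rightarrow> 'a \<Rightarrow> real \<Rightarrow> 'a" and \<omega> :: "real \<Rightarrow> real"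
begin

text \<open>The parameter of \<open>geo_comb\<close> is measured from \<open>f p\<close>, hence the
  complement to 1: the value becomes \<open>f p\<close> once \<open>k * dist x p\<close> reaches
  1.\<close>

definition cutoff :: "real \<Rightarrow> 'a \<Rightarrow> ('a \<Rightarrow> 'a) \<Rightarrow> 'a \<Rightarrow> 'a" where
  "cutoff k p f x = geo_comb G (1 - min 1 (k * dist x p)) (f p) (f x)"

text \<open>For \<open>x\<close> nearer to \<open>p\<close> than \<open>y\<close>, first change the
  proportion on the geodesic to \<open>f x\<close>, then replace \<open>f x\<close> by
  \<open>f y\<close>. By \<open>cutoff_increment\<close> the first move costs at most
  \<open>\<sigma>' * \<omega> (dist x y)\<close>, by hyperbolicity the second at most
  \<open>(1 - \<sigma>') * \<omega> (dist x y)\<close>.\<close>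

lemma cutoff_C_omega:
  assumes f: "f \<in> C_omega \<omega>" and k: "0 \<le> k"
  shows "cutoff k p f \<in> C_omega \<omega>"
proof -
  have f_le: "dist (f x) (f y) \<le> \<omega> (dist x y)" for x y
    using f C_omega_iff by blast
  have main: "dist (cutoff k p f x) (cutoff k p f y) \<le> \<omega> (dist x y)"
    if le': "dist x p \<le> dist y p" for x y
  proof -
    define \<sigma> where "\<sigma> = min 1 (k * dist x p)"
    define \<sigma>' where "\<sigma>' = min 1 (k * dist y p)"
    have \<sigma>: "0 \<le> \<sigma>" "\<sigma> \<le> \<sigma>'" "\<sigma>' \<le> 1"
      using k mult_left_mono[OF le' k] unfolding \<sigma>_def \<sigma>'_def by auto
    have "dist (cutoff k p f x) (cutoff k p f y)
        \<le> dist (geo_comb G (1 - \<sigma>) (f p) (f x)) (geo_comb G (1 - \<sigma>') (f p) (f x))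
          + dist (geo_comb G (1 - \<sigma>') (f p) (f x)) (geo_comb G (1 - \<sigma>') (f p) (f y))"
      unfolding cutoff_def \<sigma>_def \<sigma>'_def by (rule dist_triangle)
    also have "\<dots> \<le> (\<sigma>' - \<sigma>) * dist (f x) (f p) + (1 - \<sigma>') * dist (f x) (f y)"
      using \<sigma> geo_comb_dist[of "1 - \<sigma>" "1 - \<sigma>'"] geo_comb_contract[of "1 - \<sigma>'"]
      by (simp add: dist_commute)
    also have "\<dots> \<le> (\<sigma>' - \<sigma>) * \<omega> (dist x p) + (1 - \<sigma>') * \<omega> (dist x y)"
      using \<sigma> f_le by (intro add_mono mult_left_mono) auto
    also have "(\<sigma>' - \<sigma>) * \<omega> (dist x p) \<le> \<sigma>' * \<omega> (dist y p - dist x p)"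
      unfolding \<sigma>_def \<sigma>'_def using le' k by (intro cutoff_increment) auto
    also have "\<dots> \<le> \<sigma>' * \<omega> (dist x y)"
      using le' \<sigma> dist_triangle[of y p x] by (intro mult_left_mono le) (auto simp: dist_commute)
    finally show ?thesis
      by (simp add: algebra_simps)
  qed
  show ?thesis
    unfolding C_omega_iff
  proof (intro allI)
    show "dist (cutoff k p f x) (cutoff k p f y) \<le> \<omega> (dist x y)" for x y
      using main[of x y] main[of y x] by (cases "dist x p \<le> dist y p") (auto simp: dist_commute)
  qed
qed

lemma cutoff_close:
  assumes f: "f \<in> C_omega \<omega>" and k: "0 \<le> k" and "dist x p \<le> R"
  shows "dist (f x) (cutoff k p f x) \<le> k * R * \<omega> R"
proof -
  let ?\<sigma> = "min 1 (k * dist x p)"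
  have "dist (geo_comb G 1 (f p) (f x)) (geo_comb G (1 - ?\<sigma>) (f p) (f x))
      = \<bar>1 - (1 - ?\<sigma>)\<bar> * dist (f p) (f x)"
    using k by (intro geo_comb_dist) auto
  then have "dist (f x) (cutoff k p f x) = ?\<sigma> * dist (f x) (f p)"
    using k by (simp add: cutoff_def dist_commute)
  also have "\<dots> \<le> (k * R) * \<omega> R"
  proof (rule mult_mono)
    show "?\<sigma> \<le> k * R"
      using mult_left_mono[OF assms(3) k] by simp
    have "dist (f x) (f p) \<le> \<omega> (dist x p)"
      using f C_omega_iff by blast
    also have "\<dots> \<le> \<omega> R"
      using assms by (intro le) auto
    finally show "dist (f x) (f p) \<le> \<omega> R" .
    show "0 \<le> k * R"
      using k assms(3) zero_le_dist[of x p] by (intro mult_nonneg_nonneg) linarith+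
  qed simp
  finally show ?thesis .
qed

text \<open>The hypothesis \<open>far\<close> is what permits gluing: at some distance
  \<open>T\<close>, \<omega> allows jumps from \<open>f p\<close> and from \<open>c\<close> to every
  value of \<open>f\<close> on a given ball. Bounded and unbounded \<omega> both reduce to this
  construction, with different choices of \<open>c\<close> and \<open>p\<close>.\<close>

lemma bump_approximation:
  fixes f :: "'a \<Rightarrow> 'a"
  assumes f: "f \<in> C_omega \<omega>" and s: "0 \<le> s" and v: "0 \<le> v" "v \<le> \<omega> s"
    and c: "v \<le> dist (f p) c"
    and far: "\<And>R. \<exists>T. 0 \<le> T \<and> (\<forall>y. dist y p \<le> R \<longrightarrow> dist (f p) (f y) \<le> \<omega> T \<and> dist c (f y) \<le> \<omega> T)"
    and R: "0 < R" and e: "0 < e"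
  obtains h where "h \<in> C_omega \<omega>" "\<And>x. dist x p \<le> R \<Longrightarrow> dist (f x) (h x) \<le> e"
    "\<exists>x y. dist x y \<le> s \<and> v \<le> dist (h x) (h y)"
proof -
  \<comment> \<open>The first bound gives \<open>R < 1 / k\<close>, so the ball of radius
    \<open>R\<close> lies where only the cutoff acts; the second gives
    \<open>k * R * \<omega> R \<le> e\<close>, the 1 keeping the denominator positive.\<close>
  define k where "k = min (1 / (2 * R)) (e / (R * (\<omega> R + 1)))"
  have \<omega>R: "0 \<le> \<omega> R"
    using R by (intro nonneg) simp
  have k: "0 < k"
    unfolding k_def using R e \<omega>R by simp
  have "k * (R * (\<omega> R + 1)) \<le> e / (R * (\<omega> R + 1)) * (R * (\<omega> R + 1))"
    unfolding k_def using R \<omega>R by (intro mult_right_mono) auto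
  then have "k * R * (\<omega> R + 1) \<le> e"
    using R \<omega>R by (simp add: mult.assoc)
  moreover have "k * R * \<omega> R \<le> k * R * (\<omega> R + 1)"
    using k R by (intro mult_left_mono) auto
  ultimately have small: "k * R * \<omega> R \<le> e"
    by linarith
  define g where "g = cutoff k p f"
  have g: "dist (g x) (g y) \<le> \<omega> (dist x y)" for x y
    using cutoff_C_omega[OF f, of k p] k C_omega_iff unfolding g_def by auto
  have g_const: "g x = f p" if "1 / k \<le> dist x p" for x
    using that k by (simp add: g_def cutoff_def divide_simps mult.commute)
  have "k * R \<le> 1 / (2 * R) * R"
    unfolding k_def using R by (intro mult_right_mono) auto
  then have "k * R < 1"
    using R by simp
  then have R_less: "R < 1 / k"
    using k by (simp add: divide_simps mult.commute)
  obtain T where T: "0 \<le> T"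
    "\<And>y. dist y p \<le> 1 / k \<Longrightarrow> dist (f p) (f y) \<le> \<omega> T \<and> dist c (f y) \<le> \<omega> T"
    using far[of "1 / k"] by auto
  \<comment> \<open>The bump lives within distance \<open>s\<close> of \<open>z\<close>, hence at
    distance at least \<open>T\<close> from the ball of radius \<open>1 / k\<close> about
    \<open>p\<close>.\<close>
  obtain z where z: "dist p z \<ge> 1 / k + s + T"
    by (rule far_point)
  \<comment> \<open>The parameter is \<open>v\<close> at \<open>z\<close> and vanishes from distance
    \<open>s\<close> on, as \<open>v \<le> \<omega> s\<close>. Its increments are at most those of
    \<omega>, so moving along one geodesic respects the modulus.\<close>
  define \<phi> where "\<phi> a = max 0 (v - \<omega> a)" for a
  define u where "u x = G (f p) c (\<phi> (dist x z))" for x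
  have \<phi>: "0 \<le> \<phi> a" "\<phi> a \<le> dist (f p) c" if "0 \<le> a" for a
    using c v nonneg[OF that] unfolding \<phi>_def by auto
  have u: "dist (u x) (u y) \<le> \<omega> (dist x y)" for x y
  proof -
    have "dist (u x) (u y) = \<bar>\<phi> (dist x z) - \<phi> (dist y z)\<bar>"
      unfolding u_def using \<phi> by (intro G_dist) auto
    also have "\<dots> \<le> \<bar>\<omega> (dist x z) - \<omega> (dist y z)\<bar>"
      unfolding \<phi>_def by linarith
    also have "\<dots> \<le> \<omega> \<bar>dist x z - dist y z\<bar>"
      by (rule abs_diff_le) auto
    also have "\<dots> \<le> \<omega> (dist x y)"
      using dist_triangle[of x z y] dist_triangle[of y z x] by (intro le) (auto simp: dist_commute)
    finally show ?thesis .
  qed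
  have u_const: "u x = f p" if "s \<le> dist x z" for x
    using v le[OF s that] by (simp add: u_def \<phi>_def)
  define h where "h x = (if 1 / k \<le> dist x p then u x else g x)" for x
  have mixed: "dist (u x) (g y) \<le> \<omega> (dist x y)" if x: "1 / k \<le> dist x p" and y: "dist y p < 1 / k" for x y
  proof (cases "s \<le> dist x z")
    case True
    then show ?thesis
      using u_const[OF True] g_const[OF x] g[of x y] by simp
  next
    case False
    have "dist p z \<le> dist y p + dist x y + dist x z"
      using dist_triangle[of p z y] dist_triangle[of y z x] by (simp add: dist_commute)
    then have far_apart: "T \<le> dist x y"
      using z y False by linarith
    \<comment> \<open>Convexity of balls is used twice: \<open>g y\<close> lies on a geodesic from
      \<open>f p\<close> to \<open>f y\<close>, and \<open>u x\<close> on one from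
      \<open>f p\<close> to \<open>c\<close>.\<close>
    have "dist q (g y) \<le> \<omega> T" if "q = f p \<or> q = c" for q
      unfolding g_def cutoff_def
      using that T(2)[of y] T(2)[of p] y k by (intro dist_geo_comb_le) auto
    then have "dist (g y) (u x) \<le> \<omega> T"
      unfolding u_def using \<phi> by (intro dist_G_le) (auto simp: dist_commute)
    also have "\<dots> \<le> \<omega> (dist x y)"
      using T(1) far_apart by (rule le)
    finally show ?thesis
      by (simp add: dist_commute)
  qed
  show thesis
  proof
    show "h \<in> C_omega \<omega>"
      unfolding C_omega_iff
    proof (intro allI)
      show "dist (h x) (h y) \<le> \<omega> (dist x y)" for x y
        using u[of x y] g[of x y] mixed[of x y] mixed[of y x]
        by (auto simp: h_def dist_commute not_le)
    qed
    show "dist (f x) (h x) \<le> e" if "dist x p \<le> R" for x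
      using cutoff_close[OF f, of k x p R] that small R_less k by (simp add: h_def g_def)
    show "\<exists>x y. dist x y \<le> s \<and> v \<le> dist (h x) (h y)"
    proof -
      \<comment> \<open>A geodesic from \<open>z\<close> to a remote point supplies \<open>y\<close>
        at distance exactly \<open>s\<close> from \<open>z\<close>, where the bump has already
        vanished.\<close>
      obtain w where w: "dist z w \<ge> s"
        by (rule far_point)
      define y where "y = G z w s"
      have zy: "dist z y = s"
        using G_dist[of 0 z w s] w s by (simp add: y_def)
      have "dist p z \<le> dist y p + dist z y"
        using dist_triangle[of p z y] by (simp add: dist_commute)
      then have "h y = f p" "h z = G (f p) c v"
        using z zy T(1) s v u_const[of y]
        by (auto simp: h_def u_def \<phi>_def dist_commute zero)
      moreover have "dist (G (f p) c v) (G (f p) c 0) = v"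
        using G_dist[of v "f p" c 0] v c by simp
      ultimately show ?thesis
        using zy by (intro exI[of _ z] exI[of _ y]) simp
    qed
  qed
qed

text \<open>Along a geodesic from a point of the range of f to a remote point, the largest
  distance to the range varies continuously, from at most D to at least b.\<close>

lemma point_near_range:
  fixes f :: "'b \<Rightarrow> 'a"
  assumes D: "\<And>x y. dist (f x) (f y) \<le> D" and "D \<le> b" "v < b"
  obtains c p where "\<And>y. dist c (f y) \<le> b" "v < dist (f p) c"
proof -
  fix x1 :: 'b
  obtain w where w: "dist (f x1) w \<ge> b"
    by (rule far_point)
  define q where "q = G (f x1) w"
  define m where "m t = (SUP y. dist (q t) (f y))" for t
  have bdd: "bdd_above (range (\<lambda>y. dist (q t) (f y)))" for t
    using dist_triangle[of "q t" "f _" "f x1"] D[of x1]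
    by (intro bdd_aboveI2[where M = "dist (q t) (f x1) + D"]) (smt (verit))
  have upper: "dist (q t) (f y) \<le> m t" for t y
    unfolding m_def by (rule cSUP_upper) (auto intro: bdd)
  \<comment> \<open>A supremum of distances to fixed points is 1-Lipschitz along the isometric curve
    \<open>q\<close>.\<close>
  have lipschitz: "m t \<le> m t' + \<bar>t - t'\<bar>"
    if "0 \<le> t" "t \<le> dist (f x1) w" "0 \<le> t'" "t' \<le> dist (f x1) w" for t t'
    unfolding m_def[of t]
  proof (rule cSUP_least)
    show "dist (q t) (f y) \<le> m t' + \<bar>t - t'\<bar>" for y
      using dist_triangle[of "q t" "f y" "q t'"] upper[of t' y] G_dist[OF that]
      by (simp add: q_def)
  qed simp
  have "continuous_on {0..dist (f x1) w} m"
    unfolding continuous_on_iff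
  proof (intro ballI allI impI)
    fix t and e :: real assume t: "t \<in> {0..dist (f x1) w}" and "0 < e"
    have "dist (m t') (m t) < e" if "t' \<in> {0..dist (f x1) w}" "dist t' t < e" for t'
      using lipschitz[of t t'] lipschitz[of t' t] t that by (auto simp: dist_real_def)
    then show "\<exists>d>0. \<forall>t'\<in>{0..dist (f x1) w}. dist t' t < d \<longrightarrow> dist (m t') (m t) < e"
      using \<open>0 < e\<close> by blast
  qed
  moreover have "m 0 \<le> b"
    unfolding m_def q_def using D \<open>D \<le> b\<close> by (intro cSUP_least) (auto intro: order_trans)
  moreover have "b \<le> m (dist (f x1) w)"
    using upper[of "dist (f x1) w" x1] w dist_commute[of w "f x1"] by (simp add: q_def)
  ultimately obtain t where t: "m t = b"
    using IVT'[of m 0 b "dist (f x1) w"] by auto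
  have "\<exists>p. v < dist (q t) (f p)"
  proof (rule ccontr)
    assume "\<not> ?thesis"
    then have "m t \<le> v"
      unfolding m_def by (intro cSUP_least) (auto simp: not_less)
    then show False
      using t \<open>v < b\<close> by simp
  qed
  then show thesis
    using that[of "q t"] upper[of t] t by (auto simp: dist_commute)
qed

lemma contraction_C_omega:
  assumes f: "f \<in> C_omega \<omega>" and t: "0 \<le> t" "t \<le> 1"
  shows "(\<lambda>x. geo_comb G t a (f x)) \<in> C_omega \<omega>"
  unfolding C_omega_iff
proof (intro allI)
  fix x y
  have "dist (geo_comb G t a (f x)) (geo_comb G t a (f y)) \<le> t * dist (f x) (f y)"
    using t by (rule geo_comb_contract)
  also have "\<dots> \<le> dist (f x) (f y)"
    using t by (intro mult_left_le_one_le) auto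
  also have "\<dots> \<le> \<omega> (dist x y)"
    using f C_omega_iff by blast
  finally show "dist (geo_comb G t a (f x)) (geo_comb G t a (f y)) \<le> \<omega> (dist x y)" .
qed

text \<open>The two cases supply \<open>c\<close> and \<open>p\<close> for
  \<open>bump_approximation\<close>. For unbounded \<omega>, \<open>p = x0\<close> and any
  \<open>c\<close> far enough from \<open>f x0\<close> will do; for bounded \<omega>, half of the
  tolerance \<open>e\<close> is spent on contracting \<open>f\<close>.\<close>

lemma large_modulus_approximation:
  fixes f :: "'a \<Rightarrow> 'a"
  assumes f: "f \<in> C_omega \<omega>" and s: "0 \<le> s" and v: "0 \<le> v" "v < \<omega> s"
    and R: "0 < R" and e: "0 < e"
  obtains h where "h \<in> C_omega \<omega>" "\<And>x. dist x x0 \<le> R \<Longrightarrow> dist (f x) (h x) \<le> e"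
    "\<exists>x y. dist x y \<le> s \<and> v \<le> dist (h x) (h y)"
proof (cases "bdd_above (\<omega> ` {0..})")
  case False
  obtain c where c: "v \<le> dist (f x0) c"
    by (rule far_point)
  have "\<exists>T. 0 \<le> T \<and> (\<forall>y. dist y x0 \<le> r \<longrightarrow> dist (f x0) (f y) \<le> \<omega> T \<and> dist c (f y) \<le> \<omega> T)" for r
  proof -
    obtain T where T: "0 \<le> T" "\<omega> (max 0 r) + dist (f x0) c < \<omega> T"
      using False unfolding bdd_above_def by (auto simp: not_le)
    have "dist (f x0) (f y) \<le> \<omega> T \<and> dist c (f y) \<le> \<omega> T" if "dist y x0 \<le> r" for y
    proof -
      have "dist (f x0) (f y) \<le> \<omega> (dist x0 y)"
        using f C_omega_iff by blast
      also have "\<dots> \<le> \<omega> (max 0 r)"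
        using that by (intro le) (auto simp: dist_commute)
      finally show ?thesis
        using T(2) dist_triangle[of c "f y" "f x0"] zero_le_dist[of "f x0" c] dist_commute[of c "f x0"]
        by linarith
    qed
    then show ?thesis
      using T(1) by blast
  qed
  then show thesis
    using bump_approximation[OF f s v(1) less_imp_le[OF v(2)] c _ R e] that by metis
next
  case True
  define B where "B = (SUP a\<in>{0..}. \<omega> a)"
  have B: "\<omega> a \<le> B" if "0 \<le> a" for a
    unfolding B_def using that by (intro cSUP_upper True) auto
  have B_pos: "0 < B" "v < B"
    using B[OF s] v by auto
  \<comment> \<open>Contracting by \<open>1 - \<delta>\<close> moves values by at most
    \<open>\<delta> * B \<le> e / 2\<close>, and the range then has diameter at most
    \<open>(1 - \<delta>) * B < B\<close>.\<close>
  define \<delta> where "\<delta> = min 1 (e / (2 * B))"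
  have \<delta>: "0 < \<delta>" "\<delta> \<le> 1"
    using e B_pos by (auto simp: \<delta>_def)
  have "\<delta> * B \<le> e / (2 * B) * B"
    unfolding \<delta>_def using B_pos by (intro mult_right_mono) auto
  then have \<delta>_small: "\<delta> * B \<le> e / 2"
    using B_pos by simp
  have f_le_B: "dist (f x) (f y) \<le> B" for x y
    using f C_omega_iff B[of "dist x y"] by (metis order_trans zero_le_dist)
  define f1 where "f1 x = geo_comb G (1 - \<delta>) (f x0) (f x)" for x
  have f1: "f1 \<in> C_omega \<omega>"
    unfolding f1_def using contraction_C_omega[OF f, of "1 - \<delta>"] \<delta> by simp
  have f1_close: "dist (f x) (f1 x) \<le> e / 2" for x
  proof -
    have "dist (f x) (f1 x) = \<delta> * dist (f x0) (f x)"
      using geo_comb_dist[of 1 "1 - \<delta>" "f x0" "f x"] \<delta> by (simp add: f1_def)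
    also have "\<dots> \<le> \<delta> * B"
      using \<delta> f_le_B by (intro mult_left_mono) auto
    finally show ?thesis
      using \<delta>_small by linarith
  qed
  have f1_diam: "dist (f1 x) (f1 y) \<le> (1 - \<delta>) * B" for x y
  proof -
    have "dist (f1 x) (f1 y) \<le> (1 - \<delta>) * dist (f x) (f y)"
      unfolding f1_def using \<delta> by (intro geo_comb_contract) auto
    also have "\<dots> \<le> (1 - \<delta>) * B"
      using \<delta> f_le_B by (intro mult_left_mono) auto
    finally show ?thesis .
  qed
  have "(1 - \<delta>) * B < B"
    using \<delta> B_pos by simp
  \<comment> \<open>Above the diameter and above \<open>v\<close>, as
    \<open>point_near_range\<close> requires; below \<open>B\<close>, so that some
    \<open>\<omega> T\<close> exceeds \<open>b\<close>.\<close>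
  then obtain b where b: "max v ((1 - \<delta>) * B) < b" "b < B"
    using dense[of "max v ((1 - \<delta>) * B)" B] B_pos by auto
  obtain T where T: "0 \<le> T" "b < \<omega> T"
    using b(2) unfolding B_def by (subst (asm) less_cSUP_iff) (auto intro: True)
  obtain c p where c: "\<And>y. dist c (f1 y) \<le> b" and p: "v < dist (f1 p) c"
    using point_near_range[of f1 "(1 - \<delta>) * B" b v] f1_diam b by auto
  have "dist (f1 p) (f1 y) \<le> \<omega> T \<and> dist c (f1 y) \<le> \<omega> T" for y
    using c[of y] f1_diam[of p y] b T(2) by auto
  then have far: "\<exists>T. 0 \<le> T \<and>
      (\<forall>y. dist y p \<le> r \<longrightarrow> dist (f1 p) (f1 y) \<le> \<omega> T \<and> dist c (f1 y) \<le> \<omega> T)" for r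
    using T(1) by blast
  \<comment> \<open>The bump is built around \<open>p\<close>, so the radius grows until the ball
    about \<open>p\<close> contains the one about \<open>x0\<close>.\<close>
  have R': "0 < R + dist x0 p" and e': "0 < e / 2"
    using R e by (auto intro: add_pos_nonneg)
  obtain h where h: "h \<in> C_omega \<omega>" "\<exists>x y. dist x y \<le> s \<and> v \<le> dist (h x) (h y)"
    and h_close: "\<And>x. dist x p \<le> R + dist x0 p \<Longrightarrow> dist (f1 x) (h x) \<le> e / 2"
    using bump_approximation[OF f1 s v(1) less_imp_le[OF v(2)] less_imp_le[OF p] far R' e'] by metis
  have "dist (f x) (h x) \<le> e" if "dist x x0 \<le> R" for x
  proof -
    have "dist (f1 x) (h x) \<le> e / 2"
      using that dist_triangle[of x p x0] by (intro h_close) linarith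
    then show ?thesis
      using dist_triangle[of "f x" "h x" "f1 x"] f1_close[of x] by linarith
  qed
  then show thesis
    using that h by blast
qed

section \<open>Nowhere density of the sets of maps with small modulus\<close>

text \<open>A strict inequality at one pair of points survives small perturbations, so the
  complement is open; \<open>large_modulus_approximation\<close> puts points of it into every
  ball.\<close>

lemma small_modulus_nowhere_dense:
  assumes s: "0 \<le> s" and v: "0 \<le> v" "v < \<omega> s"
  shows "nowhere_dense_in (ucb_topology \<omega> x0)
           {f \<in> C_omega \<omega>. \<forall>x y. dist x y \<le> s \<longrightarrow> dist (f x) (f y :: 'a) \<le> v}"
    (is "nowhere_dense_in _ ?S")
proof -
  interpret U: Metric_space "C_omega \<omega> :: ('a \<Rightarrow> 'a) set" "ucb_dist x0"
    by (rule ucb_dist_Metric_space)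
  have complement: "C_omega \<omega> - ?S = {f \<in> C_omega \<omega>. \<exists>x y. dist x y \<le> s \<and> v < dist (f x) (f y)}"
    by (auto simp flip: not_le)
  have "openin U.mtopology (C_omega \<omega> - ?S)"
    unfolding U.openin_mtopology
  proof (intro conjI allI impI)
    fix f assume "f \<in> C_omega \<omega> - ?S"
    then obtain x y where xy: "dist x y \<le> s" "v < dist (f x) (f y)"
      unfolding complement by blast
    obtain n where n: "max (dist x x0) (dist y x0) \<le> real n"
      using real_arch_simple by blast
    \<comment> \<open>Each of the two values may move by less than half the gap; the bound 1 makes
      the truncation in the metric harmless.\<close>
    define \<eta> where "\<eta> = min 1 ((dist (f x) (f y) - v) / 2)"
    have \<eta>: "0 < \<eta>"
      using xy by (simp add: \<eta>_def)
    have "g \<in> C_omega \<omega> - ?S" if g: "g \<in> U.mball f (\<eta> / 2 ^ Suc n)" for g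
    proof -
      have g': "g \<in> C_omega \<omega>" "2 ^ Suc n * ucb_dist x0 f g < \<eta>"
        using g by (auto simp: U.in_mball field_simps)
      have "dist (f a) (g a) < (dist (f x) (f y) - v) / 2" if "dist a x0 \<le> real n" for a
        using min_dist_le_ucb_dist[of a x0 n f g] that g'(2) unfolding \<eta>_def by auto
      from this[of x] this[of y] have "v < dist (g x) (g y)"
        using n dist_triangle[of "f x" "f y" "g x"] dist_triangle[of "g x" "f y" "g y"]
        by (auto simp: dist_commute field_simps)
      then show ?thesis
        unfolding complement using g'(1) xy(1) by blast
    qed
    then have "U.mball f (\<eta> / 2 ^ Suc n) \<subseteq> C_omega \<omega> - ?S"
      by (rule subsetI)
    moreover have "0 < \<eta> / 2 ^ Suc n"
      using \<eta> by simp
    ultimately show "\<exists>r>0. U.mball f r \<subseteq> C_omega \<omega> - ?S"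
      by blast
  qed auto
  then have closed: "closedin U.mtopology ?S"
    unfolding closedin_def by auto
  have "U.mtopology interior_of ?S = {}"
  proof (rule ccontr)
    assume "U.mtopology interior_of ?S \<noteq> {}"
    then obtain f where f: "f \<in> U.mtopology interior_of ?S"
      by blast
    then obtain r where r: "0 < r" "U.mball f r \<subseteq> U.mtopology interior_of ?S"
      using openin_interior_of[of U.mtopology ?S] unfolding U.openin_mtopology by blast
    have ball: "U.mball f r \<subseteq> ?S"
      using r(2) interior_of_subset[of U.mtopology ?S] by blast
    have fC: "f \<in> C_omega \<omega>"
      using f interior_of_subset[of U.mtopology ?S] by blast
    obtain N where N: "(1/2) ^ N < r / 2"
      using real_arch_pow_inv[of "r / 2" "1/2"] r(1) by auto
    \<comment> \<open>The approximation attains its level only weakly, so a level strictly above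
      \<open>v\<close> is needed to leave the set.\<close>
    obtain v' where v': "v < v'" "v' < \<omega> s"
      using dense[OF v(2)] by blast
    have pos: "0 \<le> v'" "0 < real N + 1" "0 < r / 2"
      using v v' r(1) by auto
    obtain h where h: "h \<in> C_omega \<omega>" "\<exists>x y. dist x y \<le> s \<and> v' \<le> dist (h x) (h y)"
      and close: "\<And>x. dist x x0 \<le> real N + 1 \<Longrightarrow> dist (f x) (h x) \<le> r / 2"
      using large_modulus_approximation[OF fC s pos(1) v'(2) pos(2,3), of x0] by metis
    have "ucb_dist x0 f h \<le> r / 2 + (1/2) ^ N"
      using close r(1) by (intro ucb_dist_le) auto
    then have "h \<in> U.mball f r"
      using N h(1) fC by (simp add: U.in_mball)
    then show False
      using ball h(2) v'(1) by fastforce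
  qed
  then show ?thesis
    using closed unfolding nowhere_dense_in_def ucb_topology_def
    by (auto simp: closure_of_closedin)
qed

end

section \<open>Passage from rational to real parameters\<close>

theorem theorem3p3:
  fixes G :: "'a::complete_space \<Rightarrow> 'a \<Rightarrow> real \<Rightarrow> 'a"
    and \<omega> :: "real \<Rightarrow> real"
    and x0 :: 'a
  assumes "coherent_geodesics G"
    and "hyperbolic_geo G"
    and "\<not> bounded (UNIV :: 'a set)"
    and "continuous_on {0..} \<omega>"
    and "concave_on {0..} \<omega>"
    and "mono_on {0..} \<omega>"
    and "\<omega> 0 = 0"
    and "\<forall>s\<ge>0. \<omega> s \<ge> 0"
    and "\<exists>s\<ge>0. \<omega> s \<noteq> 0"
  shows "\<exists>M. M \<subseteq> C_omega \<omega> \<and> meagre_in (ucb_topology \<omega> x0) M \<and>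
           (\<forall>f\<in>C_omega \<omega> - M. \<forall>s\<ge>0. modulus f s = ereal (\<omega> s))"
proof -
  interpret hyperbolic_modulus G \<omega>
    by unfold_locales (use assms in auto)
  define small :: "real \<times> real \<Rightarrow> ('a \<Rightarrow> 'a) set" where
    "small = (\<lambda>(s, v). {f \<in> C_omega \<omega>. \<forall>x y. dist x y \<le> s \<longrightarrow> dist (f x) (f y) \<le> v})"
  define I where "I = {(s, v) \<in> \<rat> \<times> \<rat>. 0 \<le> s \<and> 0 \<le> v \<and> v < \<omega> s}"
  have "countable I"
    by (rule countable_subset[of _ "\<rat> \<times> \<rat>"]) (auto simp: I_def countable_rat)
  then have meagre: "meagre_in (ucb_topology \<omega> x0) (\<Union>(small ` I))"
    unfolding meagre_in_def
    by (intro exI[of _ "small ` I"])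
      (auto simp: small_def I_def intro: small_modulus_nowhere_dense)
  have "modulus f s = ereal (\<omega> s)" if f: "f \<in> C_omega \<omega> - \<Union>(small ` I)" and s: "0 \<le> s" for f s
  proof (rule antisym)
    show "modulus f s \<le> ereal (\<omega> s)"
      using f s by (auto simp: C_omega_def)
    have modulus_ge: "ereal (dist (f x) (f y)) \<le> modulus f s" if "dist x y \<le> s" for x y
      unfolding modulus_def using that by (intro SUP_upper2[of "(x, y)"]) auto
    show "ereal (\<omega> s) \<le> modulus f s"
    proof (rule ccontr)
      assume "\<not> ?thesis"
      then obtain z where z: "modulus f s < ereal z" "z < \<omega> s"
        using ereal_dense2[of "modulus f s" "\<omega> s"] by (auto simp: not_le)
      then obtain v where v: "v \<in> \<rat>" "z < v" "v < \<omega> s"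
        using Rats_dense_in_real by blast
      have "0 < z"
        using order.strict_trans1[OF modulus_ge[of x0 x0] z(1)] s by simp
      then have pos: "0 < v" "0 < \<omega> s" "0 < s"
        using v s zero by (auto simp: less_le)
      \<comment> \<open>By \<open>scale\<close>, every \<open>q\<close> between
        \<open>s * v / \<omega> s\<close> and \<open>s\<close> satisfies
        \<open>v < \<omega> q\<close>. A rational such \<open>q\<close> gives a member of
        \<open>I\<close>, and a pair at distance at most \<open>q\<close> also counts for the
        modulus at \<open>s\<close>.\<close>
      then have "s * v / \<omega> s < s"
        using v by (simp add: divide_simps)
      then obtain q where q: "q \<in> \<rat>" "s * v / \<omega> s < q" "q < s"
        using Rats_dense_in_real by blast
      have "0 \<le> s * v / \<omega> s"
        using pos by simp
      then have "0 \<le> q"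
        using q(2) by linarith
      have "v < q / s * \<omega> s"
        using q(2) pos by (simp add: divide_simps mult.commute)
      also have "\<dots> \<le> \<omega> (q / s * s)"
        using \<open>0 \<le> q\<close> q(3) pos by (intro scale) auto
      finally have "(q, v) \<in> I"
        using q(1) v(1) pos \<open>0 \<le> q\<close> by (simp add: I_def)
      then have "f \<notin> small (q, v)"
        using f by blast
      then obtain x y where xy: "dist x y \<le> q" "v < dist (f x) (f y)"
        using f by (auto simp: small_def not_le)
      have "ereal (dist (f x) (f y)) \<le> modulus f s"
        using xy(1) q(3) by (intro modulus_ge) simp
      also have "\<dots> < ereal z"
        by (rule z)
      finally show False
        using xy(2) v(2) by simp
    qed
  qed
  moreover have "\<Union>(small ` I) \<subseteq> C_omega \<omega>"
    by (auto simp: small_def)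
  ultimately show ?thesis
    using meagre by blast
qed

end
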